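(* Let $X$ be a reflexive Banach space, let $K$ be a nonempty convex closed subset of $X$, let $D\subseteq K$ be a self segment-dense set in $K$ with respect to the weak topology of $X$, and let $F:K\times K\rightrightarrows\mathbb{R}$ be a set-valued map satisfying: (i) for all $y\in D$, the map $x\mapsto F(x,y)$ is weakly lower semicontinuous on $K$; (ii) for all $x\in K$, the map $y\mapsto F(x,y)$ is weakly lower semicontinuous on $K\setminus D$; (iii) for all $x\in K$, the map $y\mapsto F(x,y)$ is convex on $K$; (iv) for all $x\in K$, $F(x,x)\ge 0$ and $0\in F(x,x)$; (v) there exists $r>0$ such that for all $x\in K$ with $\|x\|>r$ there exists $y_0\in K$ with $\|y_0\|<\|x\|$ and $F(x,y_0)\cap(-\infty,0]\neq\emptyset$. Then there exists $x_0\in K$ such that $F(x_0,y)\ge 0$ for all $y\in K$.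
   Context: Self segment-dense: for $U\subseteq V\subseteq X$ with $V$ convex and $X$ equipped with a vector topology (here the weak topology), $U$ is self segment-dense in $V$ if $U$ is dense in $V$ (i.e. $V\subseteq\operatorname{cl}(U)$) and for all $x,y\in U$ the set $[x,y]\cap U$ is dense in the closed segment $[x,y]=\{x+t(y-x):t\in[0,1]\}$. Notation: $F(x,y)\ge 0$ means $u\ge 0$ for all $u\in F(x,y)$. Lower semicontinuity: a set-valued map $T:A\rightrightarrows\mathbb{R}$ on a topological space $A$, with domain $D(T)=\{x\in A:T(x)\ne\emptyset\}$, is lower semicontinuous at $x\in D(T)$ if for every open $N\subseteq\mathbb{R}$ with $T(x)\cap N\neq\emptyset$ there is a neighborhood $M$ of $x$ in $A$ such that $T(y)\cap N\ne\emptyset$ for every $y\in M\cap D(T)$. It is lower semicontinuous on $S\subseteq A$ if it is lower semicontinuous at every point of $S$ (so in particular $S\subseteq D(T)$); here $T$ is still regarded as a map on all of $A$. Weakly lower semicontinuous means lower semicontinuous when $A=K$ carries the topology induced by the weak topology of $X$. Convexity: $T$ is convex on $K$ if for all $x_1,\dots,x_n\in K$ and $\lambda_i\ge0$ with $\sum_{i=1}^n\lambda_i=1$ one has $\sum_{i=1}^n\lambda_iT(x_i)\subseteq T\left(\sum_{i=1}^n\lambda_ix_i\right)$ (Minkowski sum). *)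

theory Defs
  imports "HOL-Analysis.Analysis"
begin

definition bidual_embedding ::
  "'a::real_normed_vector \<Rightarrow> ('a \<Rightarrow>\<^sub>L real) \<Rightarrow>\<^sub>L real"
  where "bidual_embedding x = Blinfun (\<lambda>f. blinfun_apply f x)"

lemma bidual_embedding_apply [simp]:
  "blinfun_apply (bidual_embedding x) f = blinfun_apply f x"
  by (simp add: bidual_embedding_def bounded_linear_Blinfun_apply)

definition reflexive_space :: "'a::real_normed_vector itself \<Rightarrow> bool"
  where "reflexive_space _ \<longleftrightarrow>
    surj (bidual_embedding :: 'a \<Rightarrow> ('a \<Rightarrow>\<^sub>L real) \<Rightarrow>\<^sub>L real)"

(* The initial topology induced by all bounded linear functionals: the topology on the function
   space is the product topology, as for strong_operator_topology. *)
definition weak_topology :: "'a::real_normed_vector topology"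
  where "weak_topology =
    pullback_topology UNIV (\<lambda>x (f :: 'a \<Rightarrow>\<^sub>L real). blinfun_apply f x) euclidean"

definition self_segment_dense_in ::
  "'a::real_vector topology \<Rightarrow> 'a set \<Rightarrow> 'a set \<Rightarrow> bool"
  where "self_segment_dense_in \<tau> U V \<longleftrightarrow>
    U \<subseteq> V \<and> convex V \<and> V \<subseteq> \<tau> closure_of U \<and>
    (\<forall>x\<in>U. \<forall>y\<in>U. closed_segment x y \<subseteq> \<tau> closure_of (closed_segment x y \<inter> U))"

definition svm_domain :: "'a set \<Rightarrow> ('a \<Rightarrow> 'b set) \<Rightarrow> 'a set"
  where "svm_domain A T = {x \<in> A. T x \<noteq> {}}"

(* The set-valued map has source topspace A; its values elsewhere are irrelevant. *)
definition lower_semicontinuous_at ::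
  "'a topology \<Rightarrow> ('a \<Rightarrow> real set) \<Rightarrow> 'a \<Rightarrow> bool"
  where "lower_semicontinuous_at A T x \<longleftrightarrow>
    x \<in> svm_domain (topspace A) T \<and>
    (\<forall>N. open N \<and> T x \<inter> N \<noteq> {} \<longrightarrow>
      (\<exists>M. openin A M \<and> x \<in> M \<and>
        (\<forall>y \<in> M \<inter> svm_domain (topspace A) T. T y \<inter> N \<noteq> {})))"

definition lower_semicontinuous_on ::
  "'a topology \<Rightarrow> ('a \<Rightarrow> real set) \<Rightarrow> 'a set \<Rightarrow> bool"
  where "lower_semicontinuous_on A T S \<longleftrightarrow> (\<forall>x\<in>S. lower_semicontinuous_at A T x)"

(* The outer sum of sets is the Minkowski sum of HOL-Library.Set_Algebras; the case n = 0 is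
   excluded by the weights summing to 1. *)
definition convex_svm_on :: "'a::real_vector set \<Rightarrow> ('a \<Rightarrow> real set) \<Rightarrow> bool"
  where "convex_svm_on K T \<longleftrightarrow>
    (\<forall>(n::nat) (x :: nat \<Rightarrow> 'a) (l :: nat \<Rightarrow> real).
      (\<forall>i<n. x i \<in> K) \<and> (\<forall>i<n. 0 \<le> l i) \<and> (\<Sum>i<n. l i) = 1 \<longrightarrow>
      (\<Sum>i<n. (\<lambda>u. l i * u) ` T (x i)) \<subseteq> T (\<Sum>i<n. l i *\<^sub>R x i))"

definition svm_nonneg :: "real set \<Rightarrow> bool"
  where "svm_nonneg S \<longleftrightarrow> (\<forall>u\<in>S. 0 \<le> u)"

end

theory Submission
  imports Defs
begin

text \<open>
  The norm closure of \<open>D\<close> is convex, because the weak and the norm topology agree on segments;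
  being also closed it is weakly closed by Mazur, so \<open>D\<close> is norm dense in \<open>K\<close>. Fix \<open>\<rho> > r\<close> such
  that the open ball of radius \<open>\<rho>\<close> meets \<open>K\<close>. For \<open>y \<in> D\<close> the set of \<open>x \<in> K\<close> with \<open>F(x, y) \<ge> 0\<close> is
  weakly closed, and by convexity of \<open>F(x, \<cdot>)\<close> together with \<open>F(x, x) \<ge> 0\<close> these sets have the KKM
  property. Since \<open>K \<inter> cball 0 \<rho>\<close> is weakly compact, some \<open>x0\<close> in it satisfies \<open>F(x0, y) \<ge> 0\<close>
  for all \<open>y \<in> D\<close> of norm at most \<open>\<rho>\<close>, and by lower semicontinuity and norm density for all
  \<open>y \<in> K\<close> of norm less than \<open>\<rho>\<close>. Finally there is \<open>w \<in> K\<close> inside the open ball with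
  \<open>0 \<in> F(x0, w)\<close>: either \<open>x0\<close> itself or, if its norm is \<open>\<rho>\<close>, the point given by coercivity.
  Convexity along the segment from \<open>w\<close> to an arbitrary \<open>y \<in> K\<close> then yields \<open>F(x0, y) \<ge> 0\<close>.
\<close>

section \<open>Hahn--Banach separation\<close>

text \<open>For scaling an inequality suffices, which is easier to check for infima; equality
  follows by rescaling with \<open>1 / c\<close>.\<close>

definition sublinear :: "('a::real_vector \<Rightarrow> real) \<Rightarrow> bool"
  where "sublinear p \<longleftrightarrow>
    (\<forall>x y. p (x + y) \<le> p x + p y) \<and> (\<forall>x. \<forall>c\<ge>0. p (c *\<^sub>R x) \<le> c * p x)"

lemma sublinear_add: "sublinear p \<Longrightarrow> p (x + y) \<le> p x + p y"
  and sublinear_scale_le: "sublinear p \<Longrightarrow> 0 \<le> c \<Longrightarrow> p (c *\<^sub>R x) \<le> c * p x"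
  by (auto simp: sublinear_def)

lemma sublinear_0:
  assumes "sublinear p"
  shows "p 0 = 0"
  using sublinear_add[OF assms, of 0 0] sublinear_scale_le[OF assms, of 0 0] by simp

lemma sublinear_minus: "sublinear p \<Longrightarrow> - p (- x) \<le> p x"
  using sublinear_add[of p x "- x"] sublinear_0[of p] by simp

lemma sublinear_scale:
  assumes "sublinear p" "0 \<le> c"
  shows "p (c *\<^sub>R x) = c * p x"
proof (cases "c = 0")
  case True
  then show ?thesis using sublinear_0[OF assms(1)] by simp
next
  case False
  with assms have "c > 0" by simp
  have "p x = p ((1 / c) *\<^sub>R (c *\<^sub>R x))"
    using \<open>c > 0\<close> by simp
  also have "\<dots> \<le> (1 / c) * p (c *\<^sub>R x)"
    using \<open>c > 0\<close> by (intro sublinear_scale_le assms(1)) simp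
  finally have "c * p x \<le> p (c *\<^sub>R x)"
    using \<open>c > 0\<close> by (simp add: field_simps)
  with sublinear_scale_le[OF assms, of x] show ?thesis by simp
qed

text \<open>The infimum of \<open>q (v + w) - s\<close> over \<open>W\<close> lowers
  \<open>q\<close> in the directions \<open>- w\<close>: at \<open>v = - w\<close> the term is
  \<open>q 0 - s = - s\<close>. A linear minorant of the result is then at least \<open>s\<close> at
  \<open>w\<close>. Applied to a ray this drives the minimality argument; applied to the cone over
  \<open>C - x\<close> it gives separation.\<close>

lemma sublinear_below_on_cone:
  fixes q :: "'a::real_vector \<Rightarrow> real"
  assumes q: "sublinear q" and "(0, 0) \<in> W"
    and add: "\<And>w s w' s'. (w, s) \<in> W \<Longrightarrow> (w', s') \<in> W \<Longrightarrow> (w + w', s + s') \<in> W"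
    and scale: "\<And>w s c. (w, s) \<in> W \<Longrightarrow> 0 < c \<Longrightarrow> (c *\<^sub>R w, c * s) \<in> W"
    and below: "\<And>w s. (w, s) \<in> W \<Longrightarrow> s \<le> q w"
  obtains r where "sublinear r" "\<And>v. r v \<le> q v" "\<And>w s. (w, s) \<in> W \<Longrightarrow> r (- w) \<le> - s"
proof
  define g where "g v z = q (v + fst z) - snd z" for v and z :: "'a \<times> real"
  define r where "r v = (INF z\<in>W. g v z)" for v
  have "W \<noteq> {}" using \<open>(0, 0) \<in> W\<close> by blast
  have "- q (- v) \<le> g v z" if "z \<in> W" for v z
    using sublinear_add[OF q, of "v + fst z" "- v"] below[of "fst z" "snd z"] that
    by (simp add: g_def)
  then have bdd: "bdd_below (g v ` W)" for v
    by (intro bdd_belowI2)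
  have r_le: "r v \<le> q (v + w) - s" if "(w, s) \<in> W" for v w s
    using cINF_lower[OF bdd that, of v] by (simp add: r_def g_def)
  have r_ge: "a \<le> r v" if "\<And>w s. (w, s) \<in> W \<Longrightarrow> a \<le> q (v + w) - s" for a v
    unfolding r_def by (rule cINF_greatest[OF \<open>W \<noteq> {}\<close>]) (use that in \<open>auto simp: g_def\<close>)
  show "sublinear r"
    unfolding sublinear_def
  proof (intro conjI allI impI)
    fix x y
    have "r (x + y) - (q (x + w) - s) \<le> q (y + w') - s'"
      if "(w, s) \<in> W" "(w', s') \<in> W" for w s w' s'
      using r_le[OF add[OF that], of "x + y"] sublinear_add[OF q, of "x + w" "y + w'"]
      by (simp add: algebra_simps)
    then have "r (x + y) - (q (x + w) - s) \<le> r y" if "(w, s) \<in> W" for w s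
      using that by (intro r_ge) blast
    then have "r (x + y) - r y \<le> q (x + w) - s" if "(w, s) \<in> W" for w s
      using that by (fastforce simp: algebra_simps)
    then have "r (x + y) - r y \<le> r x"
      by (intro r_ge) blast
    then show "r (x + y) \<le> r x + r y" by simp
  next
    fix x and c :: real
    assume "0 \<le> c"
    show "r (c *\<^sub>R x) \<le> c * r x"
    proof (cases "c = 0")
      case True
      then show ?thesis using r_le[OF \<open>(0, 0) \<in> W\<close>, of 0] sublinear_0[OF q] by simp
    next
      case False
      with \<open>0 \<le> c\<close> have "c > 0" by simp
      have "r (c *\<^sub>R x) / c \<le> q (x + w) - s" if "(w, s) \<in> W" for w s
      proof -
        have "r (c *\<^sub>R x) \<le> q (c *\<^sub>R (x + w)) - c * s"
          using r_le[OF scale[OF that \<open>c > 0\<close>], of "c *\<^sub>R x"] by (simp add: scaleR_add_right)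
        also have "\<dots> = c * (q (x + w) - s)"
          using sublinear_scale[OF q \<open>0 \<le> c\<close>, of "x + w"] by (simp add: right_diff_distrib)
        finally show ?thesis
          using \<open>c > 0\<close> by (simp add: field_simps)
      qed
      then have "r (c *\<^sub>R x) / c \<le> r x"
        by (intro r_ge) blast
      then show ?thesis
        using \<open>c > 0\<close> by (simp add: field_simps)
    qed
  qed
  show "r v \<le> q v" for v
    using r_le[OF \<open>(0, 0) \<in> W\<close>, of v] by simp
  show "r (- w) \<le> - s" if "(w, s) \<in> W" for w s
    using r_le[OF that, of "- w"] sublinear_0[OF q] by simp
qed

text \<open>A pointwise minimal sublinear functional is linear: lowering it along the ray through
  \<open>y\<close> cannot change it, which forces \<open>q (- y) = - q y\<close>.\<close>

theorem sublinear_dominates_linear: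
  fixes p :: "'a::real_vector \<Rightarrow> real"
  assumes p: "sublinear p"
  obtains f where "linear f" "\<And>x. f x \<le> p x"
proof -
  define A where "A = {q. sublinear q \<and> q \<le> p}"
  have "\<exists>m\<in>A. \<forall>a\<in>A. m \<ge> a \<longrightarrow> a = m"
  proof (rule predicate_Zorn)
    show "partial_order_on A (relation_of (\<ge>) A)"
      by (rule partial_order_on_relation_ofI) auto
    fix C assume "C \<in> Chains (relation_of (\<ge>) A)"
    then have C: "C \<subseteq> A" and total: "\<And>q q'. q \<in> C \<Longrightarrow> q' \<in> C \<Longrightarrow> q \<le> q' \<or> q' \<le> q"
      by (auto simp: Chains_def relation_of_def)
    show "\<exists>u\<in>A. \<forall>a\<in>C. a \<ge> u"
    proof (cases "C = {}")
      case True
      then show ?thesis using p by (auto simp: A_def)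
    next
      case False
      define u where "u x = (INF q\<in>C. q x)" for x
      have sub: "sublinear q" and le_p: "q x \<le> p x" if "q \<in> C" for q x
        using that C by (auto simp: A_def le_fun_def)
      have "- p (- x) \<le> q x" if "q \<in> C" for q x
        using sublinear_minus[OF sub[OF that], of x] le_p[OF that, of "- x"] by simp
      then have bdd: "bdd_below ((\<lambda>q. q x) ` C)" for x
        by (intro bdd_belowI2)
      have u_le: "u x \<le> q x" if "q \<in> C" for q x
        unfolding u_def by (rule cINF_lower[OF bdd that])
      have u_ge: "a \<le> u x" if "\<And>q. q \<in> C \<Longrightarrow> a \<le> q x" for a x
        unfolding u_def by (rule cINF_greatest[OF False that])
      have "sublinear u"
        unfolding sublinear_def
      proof (intro conjI allI impI)
        fix x y
        have "u (x + y) - q x \<le> q' y" if q: "q \<in> C" "q' \<in> C" for q q'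
        proof -
          \<comment> \<open>Members of a chain are comparable, so the smaller one bounds both terms
            and its own subadditivity applies.\<close>
          obtain m where m: "m \<in> C" "m \<le> q" "m \<le> q'"
            using total[OF q] q by blast
          have "u (x + y) \<le> m x + m y"
            using u_le[OF m(1)] sublinear_add[OF sub[OF m(1)]] by (rule order_trans)
          also have "\<dots> \<le> q x + q' y"
            using m(2,3) by (intro add_mono) (auto simp: le_fun_def)
          finally show ?thesis by simp
        qed
        then have "u (x + y) - q x \<le> u y" if "q \<in> C" for q
          using that by (intro u_ge) blast
        then have "u (x + y) - u y \<le> q x" if "q \<in> C" for q
          using that by (fastforce simp: algebra_simps)
        then have "u (x + y) - u y \<le> u x"
          by (intro u_ge) blast
        then show "u (x + y) \<le> u x + u y" by simp
      next
        fix x and c :: real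
        assume "0 \<le> c"
        have le: "u (c *\<^sub>R x) \<le> c * q x" if "q \<in> C" for q
          using u_le[OF that] sublinear_scale_le[OF sub[OF that] \<open>0 \<le> c\<close>] by (rule order_trans)
        show "u (c *\<^sub>R x) \<le> c * u x"
        proof (cases "c = 0")
          case True
          then show ?thesis using le False by auto
        next
          case False
          with \<open>0 \<le> c\<close> have "c > 0" by simp
          then have "u (c *\<^sub>R x) / c \<le> u x"
            using le by (intro u_ge) (simp add: field_simps)
          with \<open>c > 0\<close> show ?thesis by (simp add: field_simps)
        qed
      qed
      moreover have "u \<le> p"
        using False u_le le_p by (fastforce simp: le_fun_def intro: order_trans)
      ultimately show ?thesis
        using u_le by (auto simp: A_def le_fun_def)
    qed
  qed
  then obtain q where q: "sublinear q" "q \<le> p"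
    and min: "\<And>r. sublinear r \<Longrightarrow> r \<le> q \<Longrightarrow> r = q"
    by (auto simp: A_def)
  have neg: "q (- y) = - q y" for y
  proof -
    \<comment> \<open>The graph of \<open>t * q y\<close> over the ray through \<open>y\<close>. Its
      point at \<open>t = 1\<close> yields \<open>r (- y) \<le> - q y\<close>, and minimality
      identifies \<open>r\<close> with \<open>q\<close>.\<close>
    define W where "W = (\<lambda>t::real. (t *\<^sub>R y, t * q y)) ` {0..}"
    obtain r where r: "sublinear r" "\<And>v. r v \<le> q v" "\<And>w s. (w, s) \<in> W \<Longrightarrow> r (- w) \<le> - s"
    proof (rule sublinear_below_on_cone[OF q(1), of W])
      show "(0, 0) \<in> W" by (auto simp: W_def image_iff)
      show "(w + w', s + s') \<in> W" if "(w, s) \<in> W" "(w', s') \<in> W" for w s w' s'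
      proof -
        from that obtain t t' where "t \<ge> 0" "t' \<ge> 0" "w = t *\<^sub>R y" "s = t * q y"
            "w' = t' *\<^sub>R y" "s' = t' * q y"
          by (auto simp: W_def)
        then show ?thesis
          unfolding W_def by (intro image_eqI[of _ _ "t + t'"]) (auto simp: algebra_simps)
      qed
      show "(c *\<^sub>R w, c * s) \<in> W" if "(w, s) \<in> W" "0 < c" for w s c
      proof -
        from that obtain t where "t \<ge> 0" "w = t *\<^sub>R y" "s = t * q y"
          by (auto simp: W_def)
        then show ?thesis
          unfolding W_def using \<open>0 < c\<close> by (intro image_eqI[of _ _ "c * t"]) auto
      qed
      show "s \<le> q w" if "(w, s) \<in> W" for w s
        using that sublinear_scale[OF q(1)] by (auto simp: W_def)
    qed blast
    have "(y, q y) \<in> W" by (auto simp: W_def image_iff intro!: bexI[of _ 1])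
    then have "r (- y) \<le> - q y" by (rule r(3))
    moreover have "r = q" using r by (intro min) (auto simp: le_fun_def)
    ultimately show ?thesis
      using sublinear_minus[OF q(1), of "- y"] by simp
  qed
  have add: "q (x + y) = q x + q y" for x y
    using sublinear_add[OF q(1), of x y] sublinear_add[OF q(1), of "- x" "- y"] neg[of x] neg[of y]
      neg[of "x + y"] by simp
  moreover have "q (c *\<^sub>R x) = c * q x" for c x
  proof (cases "c \<ge> 0")
    case False
    then show ?thesis
      using sublinear_scale[OF q(1), of "- c" x] neg[of "c *\<^sub>R x"] by simp
  qed (simp add: sublinear_scale[OF q(1)])
  ultimately have "linear q"
    by (intro linearI) simp_all
  with q(2) that show ?thesis by (auto simp: le_fun_def)
qed

text \<open>Every \<open>c - x\<close> has norm at least the distance \<open>d > 0\<close>, so the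
  norm can be lowered along the cone generated by \<open>C - x\<close>, with \<open>d\<close>
  assigned to each \<open>c - x\<close>. A linear minorant is bounded by the norm and grows by at
  least \<open>d\<close> from \<open>x\<close> to any point of \<open>C\<close>.\<close>

theorem separating_functional_closed_convex:
  fixes C :: "'a::real_normed_vector set"
  assumes "closed C" "convex C" "x \<notin> C"
  obtains f :: "'a \<Rightarrow>\<^sub>L real" and b where "f x < b" "\<And>c. c \<in> C \<Longrightarrow> b \<le> f c"
proof (cases "C = {}")
  case True
  then show ?thesis using that[of 0 1] by simp
next
  case False
  define d where "d = infdist x C"
  have "d > 0"
    unfolding d_def using assms False by (simp add: infdist_pos_not_in_closed)
  have d: "d \<le> norm (c - x)" if "c \<in> C" for c
    using infdist_le[OF that, of x] by (simp add: d_def dist_norm norm_minus_commute)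
  define W where "W = {(t *\<^sub>R (c - x), t * d) | t c. 0 \<le> t \<and> c \<in> C}"
  obtain r where r: "sublinear r" "\<And>v. r v \<le> norm v" "\<And>w s. (w, s) \<in> W \<Longrightarrow> r (- w) \<le> - s"
  proof (rule sublinear_below_on_cone[of norm W])
    show "sublinear (norm :: 'a \<Rightarrow> real)"
      by (auto simp: sublinear_def norm_triangle_ineq)
    show "(0, 0) \<in> W" using False by (force simp: W_def)
    show "(w + w', s + s') \<in> W" if "(w, s) \<in> W" "(w', s') \<in> W" for w s w' s'
    proof -
      from that obtain t c t' c' where *: "0 \<le> t" "c \<in> C" "w = t *\<^sub>R (c - x)" "s = t * d"
          "0 \<le> t'" "c' \<in> C" "w' = t' *\<^sub>R (c' - x)" "s' = t' * d"
        by (auto simp: W_def)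
      show ?thesis
      proof (cases "t + t' = 0")
        case True
        then have "t = 0" "t' = 0" using * by auto
        with * show ?thesis by (force simp: W_def)
      next
        case False
        with * have pos: "t + t' > 0" by simp
        \<comment> \<open>A weighted mean of \<open>c\<close> and \<open>c'\<close>, so that the sum
          of two multiples of generators is again a multiple of one generator
          \<open>e - x\<close>.\<close>
        define e where "e = (t / (t + t')) *\<^sub>R c + (t' / (t + t')) *\<^sub>R c'"
        have "e \<in> C"
          unfolding e_def using * pos
          by (intro convexD[OF assms(2)]) (auto simp: add_divide_distrib[symmetric])
        moreover have "(t + t') *\<^sub>R e = t *\<^sub>R c + t' *\<^sub>R c'"
          using pos by (simp add: e_def scaleR_add_right)
        then have "w + w' = (t + t') *\<^sub>R (e - x)"
          by (simp add: * algebra_simps)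
        moreover have "s + s' = (t + t') * d"
          by (simp add: * algebra_simps)
        ultimately show ?thesis
          using pos by (force simp: W_def)
      qed
    qed
    show "(c *\<^sub>R w, c * s) \<in> W" if "(w, s) \<in> W" "0 < c" for w s c
    proof -
      from that obtain t a where *: "0 \<le> t" "a \<in> C" "w = t *\<^sub>R (a - x)" "s = t * d"
        by (auto simp: W_def)
      then have "c *\<^sub>R w = (c * t) *\<^sub>R (a - x)" "c * s = (c * t) * d" "0 \<le> c * t"
        using \<open>0 < c\<close> by simp_all
      with \<open>a \<in> C\<close> show ?thesis unfolding W_def by blast
    qed
    show "s \<le> norm w" if "(w, s) \<in> W" for w s
      using that d by (auto simp: W_def intro!: mult_left_mono)
  qed blast
  obtain g where g: "linear g" "\<And>v. g v \<le> r v"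
    using sublinear_dominates_linear[OF r(1)] by blast
  have g_le: "g v \<le> norm v" for v
    using g(2) r(2) by (rule order_trans)
  have "\<bar>g v\<bar> \<le> norm v" for v
    using g_le[of v] g_le[of "- v"] linear_neg[OF g(1), of v] by simp
  then have "bounded_linear g"
    using g(1) by (intro bounded_linear.intro) (auto simp: bounded_linear_axioms_def intro!: exI[of _ 1])
  then have app: "blinfun_apply (Blinfun g) = g"
    by (rule bounded_linear_Blinfun_apply)
  have "g x + d \<le> g c" if "c \<in> C" for c
  proof -
    have "(c - x, d) \<in> W"
      unfolding W_def using that by (force intro: exI[of _ 1])
    then have "r (- (c - x)) \<le> - d" by (rule r(3))
    then have "g (- (c - x)) \<le> - d" using g(2) by (rule order_trans[rotated])
    then show ?thesis
      by (simp add: linear_diff[OF g(1)])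
  qed
  with \<open>d > 0\<close> show ?thesis
    by (intro that[of "Blinfun g" "g x + d"]) (auto simp: app)
qed

section \<open>The weak topology\<close>

lemma topspace_weak_topology [simp]: "topspace weak_topology = UNIV"
  by (simp add: weak_topology_def topspace_pullback_topology)

lemma continuous_map_weak_topology_blinfun_apply:
  "continuous_map weak_topology euclideanreal (blinfun_apply f)"
proof -
  have "continuous_map (weak_topology :: 'a topology) euclideanreal
      ((\<lambda>h. h f) \<circ> (\<lambda>x (g :: 'a \<Rightarrow>\<^sub>L real). blinfun_apply g x))"
    unfolding weak_topology_def
    by (rule continuous_map_pullback) simp
  then show ?thesis by (simp add: o_def)
qed

text \<open>Mazur's theorem: a separating functional puts each outside point in a weakly open
  half-space that misses \<open>C\<close>.\<close>

theorem closedin_weak_topology_convex: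
  assumes "closed C" "convex C"
  shows "closedin weak_topology C"
proof -
  have "openin weak_topology (- C)"
  proof (subst openin_subopen, intro ballI)
    fix x assume "x \<in> - C"
    then obtain f :: "'a \<Rightarrow>\<^sub>L real" and b where f: "f x < b" "\<And>c. c \<in> C \<Longrightarrow> b \<le> f c"
      using separating_functional_closed_convex[OF assms] by auto
    have "openin weak_topology {y \<in> topspace weak_topology. f y \<in> {..<b}}"
      by (rule openin_continuous_map_preimage[OF continuous_map_weak_topology_blinfun_apply]) simp
    then show "\<exists>T. openin weak_topology T \<and> x \<in> T \<and> T \<subseteq> - C"
      using f by (intro exI[of _ "{y. f y < b}"]) force
  qed
  then show ?thesis by (simp add: closedin_def Compl_eq_Diff_UNIV)
qed

lemma open_if_openin_weak_topology:
  assumes "openin weak_topology U"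
  shows "open U"
proof -
  obtain V where "open V" and U: "U = (\<lambda>x (f :: 'a \<Rightarrow>\<^sub>L real). blinfun_apply f x) -` V"
    using assms by (auto simp: weak_topology_def openin_pullback_topology)
  then show ?thesis
    by (auto intro!: open_vimage continuous_on_coordinatewise_then_product continuous_intros)
qed

lemma closed_if_closedin_weak_topology: "closedin weak_topology C \<Longrightarrow> closed C"
  using open_if_openin_weak_topology[of "- C"]
  by (simp add: closedin_def closed_def Compl_eq_Diff_UNIV)

text \<open>By Tychonoff, the linear functionals on the dual bounded by \<open>b * norm f\<close>
  form a compact set in the product topology. Reflexivity realises each of them as evaluation at a
  point, and weak closedness of \<open>C\<close> makes its image a closed part of that compact
  set.\<close>

theorem compactin_weak_topology_convex:
  fixes C :: "'a::real_normed_vector set"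
  assumes refl: "reflexive_space TYPE('a)"
    and C: "closed C" "convex C" "bounded C"
  shows "compactin weak_topology C"
proof -
  define e where "e = (\<lambda>x (f :: 'a \<Rightarrow>\<^sub>L real). blinfun_apply f x)"
  obtain b where b: "\<And>x. x \<in> C \<Longrightarrow> norm x \<le> b"
    using C(3) by (auto simp: bounded_iff)
  define L where "L = {\<phi> :: ('a \<Rightarrow>\<^sub>L real) \<Rightarrow> real. (\<forall>f g. \<phi> (f + g) = \<phi> f + \<phi> g) \<and>
    (\<forall>c f. \<phi> (c *\<^sub>R f) = c * \<phi> f) \<and> (\<forall>f. \<bar>\<phi> f\<bar> \<le> b * norm f)}"
  define B where "B = (\<Pi>\<^sub>E f\<in>(UNIV :: ('a \<Rightarrow>\<^sub>L real) set). {- (b * norm f)..b * norm f})"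
  have "compact B"
    unfolding B_def
    by (subst compactin_euclidean_iff[symmetric], subst euclidean_product_topology[symmetric],
        subst compactin_PiE) (auto simp: compactin_euclidean_iff)
  moreover have "closed L"
    unfolding L_def
    by (intro closed_Collect_conj closed_Collect_all closed_Collect_eq closed_Collect_le
        continuous_intros continuous_on_product_coordinates)
  moreover have "L \<subseteq> B"
    by (auto simp: L_def B_def abs_le_iff) (metis minus_le_iff)
  ultimately have "compact L"
    by (metis compact_Int_closed inf.absorb_iff2)
  have L_range: "\<exists>x. \<phi> = e x" if "\<phi> \<in> L" for \<phi>
  proof -
    have "bounded_linear \<phi>"
      using that unfolding L_def
      by (intro bounded_linear_intro[of _ b]) (auto simp: mult.commute)
    then have app: "blinfun_apply (Blinfun \<phi>) = \<phi>"
      by (rule bounded_linear_Blinfun_apply)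
    obtain x where "Blinfun \<phi> = bidual_embedding x"
      using refl unfolding reflexive_space_def by (metis surjD)
    then have "\<phi> f = e x f" for f
      using app by (metis bidual_embedding_apply e_def)
    then show ?thesis by blast
  qed
  have "e ` C \<subseteq> L"
  proof safe
    fix x assume "x \<in> C"
    have "\<bar>blinfun_apply f x\<bar> \<le> b * norm f" for f :: "'a \<Rightarrow>\<^sub>L real"
    proof -
      have "\<bar>blinfun_apply f x\<bar> \<le> norm f * norm x"
        using norm_blinfun[of f x] by simp
      also have "\<dots> \<le> norm f * b"
        using b[OF \<open>x \<in> C\<close>] by (intro mult_left_mono) auto
      finally show ?thesis by (simp add: mult.commute)
    qed
    then show "e x \<in> L"
      by (auto simp: L_def e_def blinfun.add_left blinfun.scaleR_left)
  qed
  have "openin weak_topology (- C)"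
    using closedin_weak_topology_convex[OF C(1,2)] by (simp add: closedin_def Compl_eq_Diff_UNIV)
  then obtain V where "open V" and V: "- C = e -` V"
    by (auto simp: weak_topology_def openin_pullback_topology e_def)
  \<comment> \<open>The complement of \<open>C\<close> is a full preimage under \<open>e\<close>, so
    a point of \<open>L\<close> outside \<open>V\<close> can only come from
    \<open>C\<close>.\<close>
  have "e ` C = L \<inter> - V"
    using \<open>e ` C \<subseteq> L\<close> V L_range by fastforce
  with \<open>compact L\<close> \<open>open V\<close> have cpt: "compact (e ` C)"
    by (simp add: compact_Int_closed closed_Compl)
  show ?thesis
    unfolding compactin_def
  proof (intro conjI allI impI)
    fix \<U> assume \<U>: "(\<forall>U\<in>\<U>. openin weak_topology U) \<and> C \<subseteq> \<Union> \<U>"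
    then have "\<forall>U\<in>\<U>. \<exists>W. open W \<and> U = e -` W"
      by (auto simp: weak_topology_def openin_pullback_topology e_def)
    \<comment> \<open>Weakly open sets are preimages under \<open>e\<close>, so a cover of
      \<open>C\<close> transfers to its image and a finite subcover transfers back.\<close>
    then obtain W where W: "\<And>U. U \<in> \<U> \<Longrightarrow> open (W U) \<and> U = e -` W U"
      by metis
    have "e ` C \<subseteq> (\<Union>U\<in>\<U>. W U)"
    proof safe
      fix x assume "x \<in> C"
      with \<U> obtain U where "U \<in> \<U>" "x \<in> U" by blast
      then show "e x \<in> (\<Union>U\<in>\<U>. W U)" using W[of U] by blast
    qed
    then obtain \<F> where \<F>: "\<F> \<subseteq> \<U>" "finite \<F>" "e ` C \<subseteq> (\<Union>U\<in>\<F>. W U)"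
      using compactE_image[OF cpt, of \<U> W] W by metis
    moreover have "C \<subseteq> \<Union> \<F>"
    proof
      fix x assume "x \<in> C"
      then obtain U where "U \<in> \<F>" "e x \<in> W U" using \<F>(3) by blast
      then show "x \<in> \<Union> \<F>" using W[of U] \<F>(1) by blast
    qed
    ultimately show "\<exists>\<F>. finite \<F> \<and> \<F> \<subseteq> \<U> \<and> C \<subseteq> \<Union> \<F>"
      by blast
  qed simp
qed

text \<open>A functional separating \<open>x\<close> from \<open>y\<close> recovers the position on
  the segment, so weak closeness there controls the norm distance.\<close>

lemma weak_closure_of_segment_subset_closure:
  fixes x y :: "'a::real_normed_vector"
  assumes "S \<subseteq> closed_segment x y"
  shows "closed_segment x y \<inter> weak_topology closure_of S \<subseteq> closure S"
proof safe
  fix z assume z: "z \<in> closed_segment x y" "z \<in> weak_topology closure_of S"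
  show "z \<in> closure S"
  proof (cases "x = y")
    case True
    have "S \<noteq> {}" using z(2) by auto
    then obtain s where "s \<in> S" by blast
    with True z(1) assms have "z = s" by auto
    with \<open>s \<in> S\<close> show ?thesis by (simp add: closure_subset[THEN subsetD])
  next
    case False
    then obtain f :: "'a \<Rightarrow>\<^sub>L real" and b where "f y < b" "b \<le> f x"
      using separating_functional_closed_convex[of "{x}" y] by auto
    then have gap: "f x - f y > 0" by simp
    show ?thesis
      unfolding closure_approachable
    proof (intro allI impI)
      fix \<epsilon> :: real assume "\<epsilon> > 0"
      \<comment> \<open>On the segment, \<open>f\<close> scales distances by the factor
        \<open>(f x - f y) / norm (x - y)\<close>, so tolerance \<open>\<delta>\<close> for
        \<open>f\<close> amounts to tolerance \<open>\<epsilon>\<close> for the norm.\<close>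
      define \<delta> where "\<delta> = \<epsilon> * (f x - f y) / norm (x - y)"
      have "\<delta> > 0" using \<open>\<epsilon> > 0\<close> gap False by (simp add: \<delta>_def)
      have "openin weak_topology {w \<in> topspace weak_topology. f w \<in> ball (f z) \<delta>}"
        by (rule openin_continuous_map_preimage[OF continuous_map_weak_topology_blinfun_apply]) simp
      then have "openin weak_topology {w. f w \<in> ball (f z) \<delta>}"
        by simp
      moreover have "z \<in> {w. f w \<in> ball (f z) \<delta>}"
        using \<open>\<delta> > 0\<close> by simp
      ultimately obtain s where "s \<in> S" "s \<in> {w. f w \<in> ball (f z) \<delta>}"
        using z(2)[unfolded in_closure_of, THEN conjunct2, THEN spec] by (metis (no_types))
      then have s: "s \<in> S" "\<bar>f z - f s\<bar> < \<delta>"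
        by (simp_all add: dist_real_def)
      obtain t where t: "z = (1 - t) *\<^sub>R x + t *\<^sub>R y"
        using z(1) by (auto simp: in_segment)
      obtain t' where t': "s = (1 - t') *\<^sub>R x + t' *\<^sub>R y"
        using subsetD[OF assms s(1)] by (auto simp: in_segment)
      have diff: "z - s = (t' - t) *\<^sub>R (x - y)"
        by (simp add: t t' algebra_simps)
      then have "f z - f s = (t' - t) * (f x - f y)"
        by (metis blinfun.diff_right blinfun.scaleR_right real_scaleR_def)
      with s(2) gap have "\<bar>t' - t\<bar> * (f x - f y) < \<delta>"
        by (simp add: abs_mult)
      then have "\<bar>t' - t\<bar> * norm (x - y) * (f x - f y) < \<epsilon> * (f x - f y)"
        using False by (simp add: \<delta>_def pos_less_divide_eq mult.assoc mult.commute mult.left_commute)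
      then have "\<bar>t' - t\<bar> * norm (x - y) < \<epsilon>"
        using gap by (simp only: mult_less_cancel_right_pos)
      then have "dist s z < \<epsilon>"
        by (simp add: dist_norm norm_minus_commute[of s] diff)
      with s(1) show "\<exists>s\<in>S. dist s z < \<epsilon>" by blast
    qed
  qed
qed

text \<open>Weak density alone need not provide points of \<open>D\<close> inside a norm ball; the
  segment condition upgrades it.\<close>

theorem self_segment_dense_in_weak_topology_norm_dense:
  fixes D K :: "'a::real_normed_vector set"
  assumes "self_segment_dense_in weak_topology D K"
  shows "K \<subseteq> closure D"
proof -
  have seg: "closed_segment x y \<subseteq> closure D" if "x \<in> D" "y \<in> D" for x y
  proof -
    have "closed_segment x y \<subseteq> weak_topology closure_of (closed_segment x y \<inter> D)"
      using assms that by (simp add: self_segment_dense_in_def)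
    then have "closed_segment x y \<subseteq> closure (closed_segment x y \<inter> D)"
      using weak_closure_of_segment_subset_closure[of "closed_segment x y \<inter> D" x y] by blast
    also have "\<dots> \<subseteq> closure D" by (intro closure_mono) simp
    finally show ?thesis .
  qed
  have "convex (closure D)"
    unfolding convex_alt
  proof (intro ballI allI impI)
    fix x y and t :: real
    assume "x \<in> closure D" "y \<in> closure D" and t: "0 \<le> t \<and> t \<le> 1"
    \<comment> \<open>For fixed \<open>t\<close> the combination is continuous on pairs, so the
      inclusion of segments passes from points of \<open>D\<close> to points of its closure.\<close>
    define h where "h z = (1 - t) *\<^sub>R fst z + t *\<^sub>R snd z" for z :: "'a \<times> 'a"
    have "h ` closure (D \<times> D) \<subseteq> closure D"
    proof (rule image_closure_subset)
      show "continuous_on (closure (D \<times> D)) h"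
        unfolding h_def by (intro continuous_intros)
      show "h ` (D \<times> D) \<subseteq> closure D"
        using seg t by (fastforce simp: h_def in_segment)
    qed simp
    then have "h (x, y) \<in> closure D"
      using \<open>x \<in> closure D\<close> \<open>y \<in> closure D\<close> by (auto simp: closure_Times)
    then show "(1 - t) *\<^sub>R x + t *\<^sub>R y \<in> closure D"
      by (simp add: h_def)
  qed
  then have "closedin weak_topology (closure D)"
    by (intro closedin_weak_topology_convex) simp_all
  then have "weak_topology closure_of D \<subseteq> closure D"
    by (intro closure_of_minimal closure_subset)
  with assms show ?thesis
    by (auto simp: self_segment_dense_in_def)
qed

section \<open>The theorems of Brouwer and Knaster--Kuratowski--Mazurkiewicz\<close>

lemma compact_unit_cube: "compact {x :: 'i \<Rightarrow> real. \<forall>i. x i \<in> {0..1}}"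
proof -
  have "{x :: 'i \<Rightarrow> real. \<forall>i. x i \<in> {0..1}} = (\<Pi>\<^sub>E i\<in>UNIV. {0..1})"
    by auto
  then show ?thesis
    by (subst compactin_euclidean_iff[symmetric], subst euclidean_product_topology[symmetric])
      (simp add: compactin_PiE compactin_euclidean_iff)
qed

text \<open>The dimension \<open>n\<close> is a term rather than a type because KKM needs arbitrarily many vertices;
  the coordinates with index at least \<open>n\<close> are irrelevant.\<close>

theorem brouwer_unit_cube_nat:
  fixes f :: "(nat \<Rightarrow> real) \<Rightarrow> nat \<Rightarrow> real"
  assumes maps: "\<And>x i. (\<And>j. x j \<in> {0..1}) \<Longrightarrow> i < n \<Longrightarrow> f x i \<in> {0..1}"
    and cont: "\<And>X x i. (\<And>k j. X k j \<in> {0..1}) \<Longrightarrow> (\<And>j. x j \<in> {0..1}) \<Longrightarrow>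
      (\<And>j. j < n \<Longrightarrow> (\<lambda>k::nat. X k j) \<longlonglongrightarrow> x j) \<Longrightarrow> i < n \<Longrightarrow> (\<lambda>k. f (X k) i) \<longlonglongrightarrow> f x i"
  obtains x where "\<And>j. x j \<in> {0..1}" "\<And>i. i < n \<Longrightarrow> f x i = x i"
proof -
  \<comment> \<open>An integer grid of mesh \<open>1 / p\<close> in the cube; \<open>min 1\<close>
    keeps arbitrary indices inside, and coordinates from \<open>n\<close> on are set to 0.\<close>
  define g where "g p x j = (if j < n then min 1 (real (x j) / real p) else 0)"
    for p :: nat and x :: "nat \<Rightarrow> nat" and j
  have g: "g p x j \<in> {0..1}" for p x j
    by (auto simp: g_def)
  have fg: "0 \<le> f (g p x) i" "f (g p x) i \<le> 1" if "i < n" for p x i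
    using maps[OF g that] by auto
  \<comment> \<open>\<open>r\<close> and \<open>s\<close> are corners of the grid cell based at
    \<open>q\<close>; in coordinate \<open>i\<close> the map does not decrease the point of
    \<open>r\<close> and does not increase that of \<open>s\<close>.\<close>
  define Q where "Q p q r s i \<longleftrightarrow> (\<forall>j<n. q j \<le> r j \<and> r j \<le> q j + 1 \<and> q j \<le> s j \<and> s j \<le> q j + 1) \<and>
    g p r i \<le> f (g p r) i \<and> f (g p s) i \<le> g p s i" for p and q r s :: "nat \<Rightarrow> nat" and i
  have "\<exists>q. \<forall>i<n. q i < Suc p \<and> (\<exists>r s. Q (Suc p) q r s i)" for p
  proof -
    define P where "P = Suc p"
    \<comment> \<open>Label 0 marks coordinates that \<open>f\<close> does not decrease. Kuhn's
      lemma demands label 1 on the face \<open>x i = P\<close>; this is harmless, as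
      \<open>g P x i = 1\<close> bounds \<open>f\<close> from above there.\<close>
    define label :: "(nat \<Rightarrow> nat) \<Rightarrow> nat \<Rightarrow> nat" where
      "label x i = (if x i \<noteq> P \<and> g P x i \<le> f (g P x) i then 0 else 1)" for x i
    have at_0: "\<forall>x. (\<forall>i<n. x i \<le> P) \<longrightarrow> (\<forall>i<n. x i = 0 \<longrightarrow> label x i = 0)"
    proof (intro allI impI)
      fix x :: "nat \<Rightarrow> nat" and i
      assume "i < n" "x i = 0"
      then have "g P x i = 0" by (simp add: g_def)
      with fg(1)[OF \<open>i < n\<close>, of P x] \<open>x i = 0\<close> show "label x i = 0"
        by (simp add: label_def P_def)
    qed
    have labels: "0 < P" "\<forall>x. (\<forall>i<n. x i \<le> P) \<longrightarrow> (\<forall>i<n. label x i = 0 \<or> label x i = 1)"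
      "\<forall>x. (\<forall>i<n. x i \<le> P) \<longrightarrow> (\<forall>i<n. x i = P \<longrightarrow> label x i = 1)"
      by (simp_all add: label_def P_def)
    obtain q where q: "\<forall>i<n. q i < P"
      and rs: "\<forall>i<n. \<exists>r s. (\<forall>j<n. q j \<le> r j \<and> r j \<le> q j + 1) \<and>
        (\<forall>j<n. q j \<le> s j \<and> s j \<le> q j + 1) \<and> label r i \<noteq> label s i"
      by (rule kuhn_lemma[OF labels(1,2) at_0 labels(3)])
    have "\<exists>r s. Q P q r s i" if "i < n" for i
    proof -
      obtain r s where *: "\<forall>j<n. q j \<le> r j \<and> r j \<le> q j + 1" "\<forall>j<n. q j \<le> s j \<and> s j \<le> q j + 1"
          "label r i \<noteq> label s i"
        using rs[THEN spec, THEN mp, OF \<open>i < n\<close>] by (elim exE conjE) (rule that)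
      have up: "g P x i \<le> f (g P x) i" if "label x i = 0" for x
        using that by (auto simp: label_def split: if_splits)
      have down: "f (g P x) i \<le> g P x i" if "label x i \<noteq> 0" for x
      proof (cases "x i = P")
        case True
        then have "g P x i = 1"
          using \<open>i < n\<close> by (simp add: g_def P_def)
        then show ?thesis using fg(2)[OF \<open>i < n\<close>] by simp
      next
        case False
        then show ?thesis using that by (auto simp: label_def split: if_splits)
      qed
      \<comment> \<open>Kuhn's lemma does not say which corner carries label 0, so \<open>r\<close>
        and \<open>s\<close> may have to be swapped.\<close>
      consider "label r i = 0" "label s i \<noteq> 0" | "label s i = 0" "label r i \<noteq> 0"
        using *(3) by (metis label_def)
      then show ?thesis
      proof cases
        case 1
        with * up down show ?thesis unfolding Q_def by blast
      next
        case 2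
        with * up down have "Q P q s r i" unfolding Q_def by blast
        then show ?thesis by blast
      qed
    qed
    with q show ?thesis unfolding P_def by blast
  qed
  then obtain q where q: "\<And>p i. i < n \<Longrightarrow> q p i < Suc p"
    and "\<forall>p i. i < n \<longrightarrow> (\<exists>r s. Q (Suc p) (q p) r s i)"
    by metis
  then obtain r s where Q: "\<And>p i. i < n \<Longrightarrow> Q (Suc p) (q p) (r p i) (s p i) i"
    by metis
  define X where "X p = g (Suc p) (q p)" for p
  have "seq_compact {x :: nat \<Rightarrow> real. \<forall>i. x i \<in> {0..1}}"
    by (intro compact_imp_seq_compact compact_unit_cube)
  moreover have "\<forall>p. X p \<in> {x. \<forall>i. x i \<in> {0..1}}"
    unfolding X_def using g by blast
  ultimately obtain x \<sigma> where x: "\<forall>i. x i \<in> {0..1}" and "strict_mono \<sigma>" and lim: "(X \<circ> \<sigma>) \<longlonglongrightarrow> x"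
    unfolding seq_compact_def by blast
  have lim': "(\<lambda>k. X (\<sigma> k) j) \<longlonglongrightarrow> x j" for j
    using continuous_on_tendsto_compose[OF continuous_on_product_coordinates[of j] lim] by simp
  \<comment> \<open>Cells have side \<open>1 / Suc p\<close>, so every choice of corners shares the
    limit of the base corners.\<close>
  have near: "(\<lambda>k. g (Suc (\<sigma> k)) (y (\<sigma> k)) j) \<longlonglongrightarrow> x j"
    if y: "\<And>p. q p j \<le> y p j \<and> y p j \<le> q p j + 1" and "j < n" for y :: "nat \<Rightarrow> nat \<Rightarrow> nat" and j
  proof -
    have "\<bar>g (Suc p) (y p) j - X p j\<bar> \<le> 1 / real (Suc p)" for p
    proof -
      have "real (q p j) / real (Suc p) \<le> real (y p j) / real (Suc p)"
        using y[of p] by (simp add: divide_right_mono)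
      moreover have "real (y p j) \<le> real (q p j) + 1"
        using y[of p] by linarith
      then have "real (y p j) / real (Suc p) \<le> real (q p j) / real (Suc p) + 1 / real (Suc p)"
        by (simp add: divide_right_mono flip: add_divide_distrib)
      moreover have "\<bar>min 1 u - min 1 v\<bar> \<le> e" if "v \<le> u" "u \<le> v + e" for u v e :: real
        using that by (auto simp: min_def)
      ultimately show ?thesis
        unfolding X_def g_def using \<open>j < n\<close> by simp
    qed
    then have bound: "norm (g (Suc (\<sigma> k)) (y (\<sigma> k)) j - X (\<sigma> k) j) \<le> inverse (real (Suc (\<sigma> k)))" for k
      by (simp add: inverse_eq_divide)
    have "(\<lambda>k. inverse (real (Suc (\<sigma> k)))) \<longlonglongrightarrow> 0"
      using LIMSEQ_subseq_LIMSEQ[OF LIMSEQ_inverse_real_of_nat \<open>strict_mono \<sigma>\<close>] by (simp add: o_def)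
    then have "(\<lambda>k. g (Suc (\<sigma> k)) (y (\<sigma> k)) j - X (\<sigma> k) j) \<longlonglongrightarrow> 0"
      by (rule Lim_null_comparison[OF always_eventually, rotated]) (use bound in blast)
    from tendsto_add[OF this lim'[of j]] show ?thesis by simp
  qed
  have "f x i = x i" if "i < n" for i
  proof (rule antisym)
    have lim_f: "(\<lambda>k. f (g (Suc (\<sigma> k)) (y (\<sigma> k))) i) \<longlonglongrightarrow> f x i"
      and lim_g: "(\<lambda>k. g (Suc (\<sigma> k)) (y (\<sigma> k)) i) \<longlonglongrightarrow> x i"
      if "\<And>p j. j < n \<Longrightarrow> q p j \<le> y p j \<and> y p j \<le> q p j + 1" for y :: "nat \<Rightarrow> nat \<Rightarrow> nat"
      using x g near[of _ y] that \<open>i < n\<close> by (auto intro!: cont)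
    have r: "\<And>p j. j < n \<Longrightarrow> q p j \<le> r p i j \<and> r p i j \<le> q p j + 1"
      and s: "\<And>p j. j < n \<Longrightarrow> q p j \<le> s p i j \<and> s p i j \<le> q p j + 1"
      using Q[OF that] unfolding Q_def by blast+
    show "x i \<le> f x i"
      using lim_g[of "\<lambda>p. r p i", OF r] lim_f[of "\<lambda>p. r p i", OF r]
      by (rule LIMSEQ_le) (use Q[OF that] in \<open>auto simp: Q_def\<close>)
    show "f x i \<le> x i"
      using lim_f[of "\<lambda>p. s p i", OF s] lim_g[of "\<lambda>p. s p i", OF s]
      by (rule LIMSEQ_le) (use Q[OF that] in \<open>auto simp: Q_def\<close>)
  qed
  with x that show ?thesis by blast
qed

text \<open>If the sets \<open>C y\<close> had no common point in the hull, the map replacing barycentric coordinates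
  by weights proportional to the distances from the sets \<open>C y\<close> would have a fixed point, lying in
  no \<open>C y\<close> whose vertex it uses. In the proof, \<open>a\<close> retracts the cube onto the simplex of weights.\<close>

theorem KKM:
  fixes C :: "'a::real_normed_vector \<Rightarrow> 'a set"
  assumes "finite Y" "Y \<noteq> {}" and closed: "\<And>y. y \<in> Y \<Longrightarrow> closed (C y)"
    and cover: "\<And>Z. Z \<subseteq> Y \<Longrightarrow> convex hull Z \<subseteq> (\<Union>y\<in>Z. C y)"
  shows "convex hull Y \<inter> (\<Inter>y\<in>Y. C y) \<noteq> {}"
proof (rule ccontr)
  assume empty: "\<not> ?thesis"
  define n where "n = card Y"
  have "n > 0" using assms(1,2) by (simp add: n_def card_gt_0_iff)
  obtain v where v: "bij_betw v {..<n} Y"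
    using ex_bij_betw_nat_finite[OF assms(1)] by (auto simp: n_def atLeast0LessThan)
  then have vY: "v i \<in> Y" if "i < n" for i
    using that by (auto simp: bij_betw_def)
  have nonempty: "C y \<noteq> {}" if "y \<in> Y" for y
    using cover[of "{y}"] that by auto
  \<comment> \<open>Missing mass is spread evenly and excess mass is divided away; weights already
    summing to 1 are unchanged.\<close>
  define a where "a l i = (l i + max 0 (1 - (\<Sum>j<n. l j)) / n) / max 1 (\<Sum>j<n. l j)"
    for l :: "nat \<Rightarrow> real" and i
  define h where "h l = (\<Sum>i<n. a l i *\<^sub>R v i)" for l
  define d where "d l i = infdist (h l) (C (v i))" for l i
  define f where "f l i = d l i / (\<Sum>j<n. d l j)" for l i
  have a_nonneg: "a l i \<ge> 0" if "\<And>j. l j \<in> {0..1}" for l i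
    using that by (auto simp: a_def)
  have a_sum: "(\<Sum>i<n. a l i) = 1" for l
    using \<open>n > 0\<close> by (simp add: a_def sum.distrib max_def flip: sum_divide_distrib)
  have hull: "h l \<in> convex hull (v ` {..<n})" if "\<And>j. l j \<in> {0..1}" for l
    unfolding h_def using a_nonneg[OF that] a_sum
    by (intro convex_sum) (auto intro: hull_inc)
  have d_nonneg: "d l i \<ge> 0" for l i
    by (simp add: d_def infdist_nonneg)
  have d_0: "d l i = 0 \<longleftrightarrow> h l \<in> C (v i)" if "i < n" for l i
    unfolding d_def using closed[OF vY[OF that]] nonempty[OF vY[OF that]]
    by (simp add: in_closed_iff_infdist_zero)
  \<comment> \<open>If all distances vanished, the closed sets would share the point
    \<open>h l\<close>; hence the denominator of \<open>f\<close> is positive.\<close>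
  have d_pos: "(\<Sum>j<n. d l j) > 0" if "\<And>j. l j \<in> {0..1}" for l
  proof -
    have "h l \<in> convex hull Y" using hull[OF that] v by (simp add: bij_betw_def)
    then obtain y where "y \<in> Y" "h l \<notin> C y" using empty by blast
    then obtain i where "i < n" "h l \<notin> C (v i)"
      using v by (auto simp: bij_betw_def)
    then have "0 < d l i" using d_0[of i l] d_nonneg[of l i] by simp
    also have "\<dots> \<le> (\<Sum>j<n. d l j)"
      using \<open>i < n\<close> d_nonneg by (intro member_le_sum) auto
    finally show ?thesis .
  qed
  obtain l where l: "\<And>j. l j \<in> {0..1}" and fix_l: "\<And>i. i < n \<Longrightarrow> f l i = l i"
  proof (rule brouwer_unit_cube_nat[of n f])
    fix l :: "nat \<Rightarrow> real" and i assume l: "\<And>j. l j \<in> {0..1}" and "i < n"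
    have "d l i \<le> (\<Sum>j<n. d l j)"
      using \<open>i < n\<close> d_nonneg by (intro member_le_sum) auto
    then show "f l i \<in> {0..1}"
      using d_nonneg[of l i] d_pos[of l, OF l] by (simp add: f_def)
  next
    fix X :: "nat \<Rightarrow> nat \<Rightarrow> real" and l :: "nat \<Rightarrow> real" and i
    assume l: "\<And>j. l j \<in> {0..1}" and lim: "\<And>j. j < n \<Longrightarrow> (\<lambda>k. X k j) \<longlonglongrightarrow> l j" and "i < n"
    have "(\<lambda>k. h (X k)) \<longlonglongrightarrow> h l"
      unfolding h_def a_def using \<open>n > 0\<close>
      by (intro tendsto_intros lim) auto
    then have lim_d: "(\<lambda>k. d (X k) j) \<longlonglongrightarrow> d l j" for j
      unfolding d_def by (rule tendsto_infdist)
    have "(\<Sum>j<n. d l j) \<noteq> 0" using d_pos[of l, OF l] by simp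
    then show "(\<lambda>k. f (X k) i) \<longlonglongrightarrow> f l i"
      unfolding f_def by (intro tendsto_divide tendsto_sum lim_d)
  qed blast
  have "(\<Sum>i<n. l i) = (\<Sum>i<n. f l i)"
    using fix_l by simp
  also have "\<dots> = 1"
    using d_pos[of l, OF l] by (simp add: f_def flip: sum_divide_distrib)
  finally have sum_l: "(\<Sum>i<n. l i) = 1" .
  then have a_l: "a l i = l i" for i
    by (simp add: a_def)
  \<comment> \<open>The cover of the face spanned by the vertices of nonzero weight puts
    \<open>h l\<close> in some \<open>C (v i)\<close> with \<open>l i \<noteq> 0\<close>, yet the
    distance formula makes this fixed coordinate 0.\<close>
  define I where "I = {i. i < n \<and> l i \<noteq> 0}"
  have "I \<subseteq> {..<n}" by (auto simp: I_def)
  then have "(\<Sum>i<n. l i *\<^sub>R v i) = (\<Sum>i\<in>I. l i *\<^sub>R v i)" "(\<Sum>i<n. l i) = (\<Sum>i\<in>I. l i)"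
    by (auto intro!: sum.mono_neutral_right simp: I_def)
  then have sums: "h l = (\<Sum>i\<in>I. l i *\<^sub>R v i)" "(\<Sum>i\<in>I. l i) = 1"
    by (simp_all add: h_def a_l sum_l)
  have "h l \<in> convex hull (v ` I)"
    unfolding sums(1) using l sums(2)
    by (intro convex_sum) (auto intro: hull_inc simp: I_def)
  moreover have "v ` I \<subseteq> Y"
    using vY by (auto simp: I_def)
  ultimately obtain i where "i \<in> I" "h l \<in> C (v i)"
    using cover by blast
  then have "f l i = 0"
    using d_0[of i l] by (simp add: f_def I_def)
  with \<open>i \<in> I\<close> fix_l[of i] show False
    by (simp add: I_def)
qed

section \<open>Set-valued equilibrium problems\<close>

lemma lower_semicontinuous_atE:
  assumes "lower_semicontinuous_at A T x" "open N" "T x \<inter> N \<noteq> {}"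
  obtains M where "openin A M" "x \<in> M"
    "\<forall>y \<in> M \<inter> svm_domain (topspace A) T. T y \<inter> N \<noteq> {}"
proof -
  have "\<exists>M. openin A M \<and> x \<in> M \<and> (\<forall>y \<in> M \<inter> svm_domain (topspace A) T. T y \<inter> N \<noteq> {})"
    using assms(1)[unfolded lower_semicontinuous_at_def, THEN conjunct2, THEN spec, of N] assms(2,3)
    by simp
  then show ?thesis
    using that by blast
qed

text \<open>A negative value persists nearby, by lower semicontinuity applied to
  \<open>{..<0}\<close>, so the complement is open. Semicontinuity at every point also makes all
  values nonempty, so restricting neighbourhoods to the domain costs nothing.\<close>

lemma closedin_svm_nonneg:
  assumes "lower_semicontinuous_on A T (topspace A)"
  shows "closedin A {x \<in> topspace A. svm_nonneg (T x)}"
proof -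
  have "openin A {x \<in> topspace A. T x \<inter> {..<0} \<noteq> {}}"
  proof (subst openin_subopen, intro ballI)
    fix x assume "x \<in> {x \<in> topspace A. T x \<inter> {..<0} \<noteq> {}}"
    then have lsc: "lower_semicontinuous_at A T x" and neg: "T x \<inter> {..<0} \<noteq> {}"
      using assms by (auto simp: lower_semicontinuous_on_def)
    obtain M where "openin A M" "x \<in> M"
      and M: "\<forall>y \<in> M \<inter> svm_domain (topspace A) T. T y \<inter> {..<0} \<noteq> {}"
      using lsc open_lessThan neg by (rule lower_semicontinuous_atE)
    moreover have "M \<subseteq> svm_domain (topspace A) T"
      using openin_subset[OF \<open>openin A M\<close>] assms
      by (auto simp: lower_semicontinuous_on_def lower_semicontinuous_at_def)
    ultimately show "\<exists>M. openin A M \<and> x \<in> M \<and> M \<subseteq> {x \<in> topspace A. T x \<inter> {..<0} \<noteq> {}}"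
      using openin_subset[OF \<open>openin A M\<close>] by blast
  qed
  moreover have "topspace A - {x \<in> topspace A. svm_nonneg (T x)} =
      {x \<in> topspace A. T x \<inter> {..<0} \<noteq> {}}"
    by (force simp: svm_nonneg_def not_le)
  ultimately show ?thesis
    by (simp add: closedin_def)
qed

lemma convex_svm_onD:
  assumes "convex_svm_on K T" "a \<in> K" "b \<in> K" "u \<in> T a" "v \<in> T b" "0 \<le> t" "t \<le> 1"
  shows "(1 - t) * u + t * v \<in> T ((1 - t) *\<^sub>R a + t *\<^sub>R b)"
proof -
  define x where "x i = (if i = 0 then a else b)" for i :: nat
  define l where "l i = (if i = 0 then 1 - t else t)" for i :: nat
  have "\<forall>i<2. x i \<in> K" "\<forall>i<2. 0 \<le> l i" "(\<Sum>i<2. l i) = 1"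
    using assms by (simp_all add: x_def l_def numeral_2_eq_2)
  then have "(\<Sum>i<2. (\<lambda>u. l i * u) ` T (x i)) \<subseteq> T (\<Sum>i<2. l i *\<^sub>R x i)"
    using assms(1)[unfolded convex_svm_on_def, THEN spec, of 2, THEN spec, of x, THEN spec, of l]
    by simp
  then have "(\<lambda>u. (1 - t) * u) ` T a + (\<lambda>u. t * u) ` T b \<subseteq> T ((1 - t) *\<^sub>R a + t *\<^sub>R b)"
    by (simp add: x_def l_def numeral_2_eq_2)
  moreover have "(1 - t) * u + t * v \<in> (\<lambda>u. (1 - t) * u) ` T a + (\<lambda>u. t * u) ` T b"
    by (intro set_plus_intro imageI assms(4,5))
  ultimately show ?thesis by blast
qed

text \<open>Mixing negative values gives a negative value. This yields the KKM property: a hull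
  point \<open>x\<close> outside the sets of all its vertices would have a negative number in
  \<open>F x x\<close>.\<close>

lemma convex_svm_negative:
  assumes "convex_svm_on K T" "convex K"
  shows "convex {y \<in> K. T y \<inter> {..<0} \<noteq> {}}"
  unfolding convex_alt
proof (intro ballI allI impI)
  fix a b and t :: real
  assume "a \<in> {y \<in> K. T y \<inter> {..<0} \<noteq> {}}" "b \<in> {y \<in> K. T y \<inter> {..<0} \<noteq> {}}"
    and t: "0 \<le> t \<and> t \<le> 1"
  then obtain u v where uv: "a \<in> K" "b \<in> K" "u \<in> T a" "v \<in> T b" "u < 0" "v < 0"
    by auto
  have "(1 - t) * u + t * v \<in> T ((1 - t) *\<^sub>R a + t *\<^sub>R b)"
    using assms(1) uv t by (intro convex_svm_onD) auto
  moreover have "(1 - t) * u + t * v < 0"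
    using convex_bound_lt[of u 0 v "1 - t" t] uv t by simp
  moreover have "(1 - t) *\<^sub>R a + t *\<^sub>R b \<in> K"
    using assms(2) uv t by (simp add: convex_alt)
  ultimately show "(1 - t) *\<^sub>R a + t *\<^sub>R b \<in> {y \<in> K. T y \<inter> {..<0} \<noteq> {}}"
    by blast
qed

text \<open>KKM gives the weakly closed sets \<open>M y\<close> the finite intersection property
  inside the weakly compact \<open>C\<close>. Only \<open>y\<close> in \<open>D\<close> are treated,
  since semicontinuity in the first variable is assumed only there.\<close>

lemma equilibrium_dense_in_ball:
  fixes K D :: "'a::real_normed_vector set"
    and F :: "'a \<Rightarrow> 'a \<Rightarrow> real set"
  assumes "reflexive_space TYPE('a)" "convex K" "closed K" "D \<subseteq> K"
    and nonempty: "K \<inter> cball 0 \<rho> \<noteq> {}"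
    and lsc: "\<And>y. y \<in> D \<Longrightarrow>
      lower_semicontinuous_on (subtopology weak_topology K) (\<lambda>x. F x y) K"
    and conv: "\<And>x. x \<in> K \<Longrightarrow> convex_svm_on K (F x)"
    and diag: "\<And>x. x \<in> K \<Longrightarrow> svm_nonneg (F x x)"
  obtains x where "x \<in> K \<inter> cball 0 \<rho>" "\<And>y. y \<in> D \<inter> cball 0 \<rho> \<Longrightarrow> svm_nonneg (F x y)"
proof -
  define C where "C = K \<inter> cball 0 \<rho>"
  define M where "M y = {x \<in> K. svm_nonneg (F x y)}" for y
  have "convex C" "closed C" "bounded C"
    using assms(2,3) by (auto simp: C_def convex_Int closed_Int bounded_Int)
  then have compact: "compactin weak_topology C"
    by (intro compactin_weak_topology_convex assms(1))
  have M_closed: "closedin weak_topology (M y)" if "y \<in> D" for y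
  proof -
    have "closedin (subtopology weak_topology K) (M y)"
      using closedin_svm_nonneg[of "subtopology weak_topology K" "\<lambda>x. F x y"] lsc[OF that]
      by (simp add: M_def)
    then show ?thesis
      by (rule closedin_trans_full[OF _ closedin_weak_topology_convex[OF assms(3,2)]])
  qed
  \<comment> \<open>KKM needs a nonempty vertex set and places the common point in the hull, hence
    in \<open>C\<close>; for empty \<open>Y\<close> nonemptiness of \<open>C\<close> is
    enough.\<close>
  have fip: "C \<inter> (\<Inter>y\<in>Y. M y) \<noteq> {}" if "finite Y" "Y \<subseteq> D \<inter> cball 0 \<rho>" for Y
  proof (cases "Y = {}")
    case True
    then show ?thesis using nonempty by (simp add: C_def)
  next
    case False
    have "Y \<subseteq> C" using that(2) \<open>D \<subseteq> K\<close> by (auto simp: C_def)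
    then have hull: "convex hull Z \<subseteq> C" if "Z \<subseteq> Y" for Z
      using that \<open>convex C\<close> by (intro hull_minimal) auto
    have "convex hull Y \<inter> (\<Inter>y\<in>Y. M y) \<noteq> {}"
    proof (rule KKM[OF that(1) False])
      show "closed (M y)" if "y \<in> Y" for y
        using \<open>Y \<subseteq> D \<inter> cball 0 \<rho>\<close> that by (intro closed_if_closedin_weak_topology M_closed) auto
      show "convex hull Z \<subseteq> (\<Union>y\<in>Z. M y)" if "Z \<subseteq> Y" for Z
      proof (rule ccontr)
        assume "\<not> ?thesis"
        then obtain x where x: "x \<in> convex hull Z" "\<And>y. y \<in> Z \<Longrightarrow> x \<notin> M y" by blast
        have "x \<in> K" using x(1) hull[OF that] by (auto simp: C_def)
        have "Z \<subseteq> {y \<in> K. F x y \<inter> {..<0} \<noteq> {}}"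
          using that \<open>Y \<subseteq> C\<close> x(2) \<open>x \<in> K\<close> by (fastforce simp: C_def M_def svm_nonneg_def not_le)
        moreover have "convex {y \<in> K. F x y \<inter> {..<0} \<noteq> {}}"
          using assms(2) conv[OF \<open>x \<in> K\<close>] by (intro convex_svm_negative) auto
        ultimately have "x \<in> {y \<in> K. F x y \<inter> {..<0} \<noteq> {}}"
          by (rule hull_minimal[THEN subsetD, OF _ _ x(1)])
        with diag[OF \<open>x \<in> K\<close>] show False by (force simp: svm_nonneg_def)
      qed
    qed
    with hull[of Y] show ?thesis by blast
  qed
  have "C \<inter> \<Inter>(M ` (D \<inter> cball 0 \<rho>)) \<noteq> {}"
  proof -
    have "\<forall>N\<in>M ` (D \<inter> cball 0 \<rho>). closedin weak_topology N"
      using M_closed by blast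
    moreover have "C \<inter> \<Inter>\<F> \<noteq> {}" if "finite \<F>" "\<F> \<subseteq> M ` (D \<inter> cball 0 \<rho>)" for \<F>
      using finite_subset_image[OF that] fip by (metis (no_types))
    ultimately show ?thesis
      using compact unfolding compactin_fip by blast
  qed
  then obtain x where "x \<in> C" and x: "x \<in> \<Inter>(M ` (D \<inter> cball 0 \<rho>))"
    by blast
  show ?thesis
  proof
    show "x \<in> K \<inter> cball 0 \<rho>" using \<open>x \<in> C\<close> by (simp add: C_def)
    show "svm_nonneg (F x y)" if "y \<in> D \<inter> cball 0 \<rho>" for y
      using x that by (auto simp: M_def)
  qed
qed

text \<open>A negative value at \<open>y\<close> would persist on a weak neighbourhood. Its trace on
  \<open>U\<close> contains a point of \<open>D\<close> by norm density, against the sign condition.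
  Hypothesis \<open>dom\<close> matters because semicontinuity controls only points with nonempty
  values.\<close>

lemma svm_nonneg_dense_extension:
  fixes K D U :: "'a::real_normed_vector set"
    and T :: "'a \<Rightarrow> real set"
  assumes dense: "K \<subseteq> closure D" and "D \<subseteq> K" and "open U"
    and lsc: "lower_semicontinuous_on (subtopology weak_topology K) T (K - D)"
    and dom: "\<And>y. y \<in> D \<Longrightarrow> T y \<noteq> {}"
    and nonneg: "\<And>y. y \<in> D \<inter> U \<Longrightarrow> svm_nonneg (T y)"
    and y: "y \<in> K \<inter> U"
  shows "svm_nonneg (T y)"
proof (cases "y \<in> D")
  case True
  then show ?thesis using nonneg y by simp
next
  case False
  show ?thesis
  proof (rule ccontr)
    assume "\<not> ?thesis"
    then have neg_y: "T y \<inter> {..<0} \<noteq> {}" by (force simp: svm_nonneg_def not_le)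
    have "lower_semicontinuous_at (subtopology weak_topology K) T y"
      using lsc y False by (simp add: lower_semicontinuous_on_def)
    then obtain N where N: "openin (subtopology weak_topology K) N" "y \<in> N"
      and neg: "\<forall>z \<in> N \<inter> svm_domain (topspace (subtopology weak_topology K)) T. T z \<inter> {..<0} \<noteq> {}"
      using open_lessThan neg_y by (rule lower_semicontinuous_atE)
    obtain V where V: "openin weak_topology V" "N = V \<inter> K"
      using N(1) by (auto simp: openin_subtopology)
    have "open (V \<inter> U)"
      by (intro open_Int open_if_openin_weak_topology V(1) \<open>open U\<close>)
    moreover have "y \<in> V \<inter> U" using N(2) V(2) y by simp
    moreover have "y \<in> closure D" using dense y by blast
    ultimately have "V \<inter> U \<inter> D \<noteq> {}"
      by (subst open_Int_closure_eq_empty[symmetric]) blast+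
    then obtain z where z: "z \<in> D" "z \<in> V" "z \<in> U"
      by auto
    then have "z \<in> N" using V(2) \<open>D \<subseteq> K\<close> by blast
    moreover have "z \<in> svm_domain K T"
      using dom[OF z(1)] z(1) \<open>D \<subseteq> K\<close> by (auto simp: svm_domain_def)
    ultimately have "T z \<inter> {..<0} \<noteq> {}" using neg by simp
    with nonneg[of z] z show False by (force simp: svm_nonneg_def)
  qed
qed

text \<open>Mixing \<open>0 \<in> T w\<close> with \<open>u \<in> T y\<close> gives the value
  \<open>t * u\<close> at a point that lies in the ball for small \<open>t > 0\<close>, which forces
  \<open>u \<ge> 0\<close>.\<close>

lemma convex_svm_nonneg_from_ball:
  fixes K :: "'a::real_normed_vector set"
  assumes conv: "convex_svm_on K T" and "convex K"
    and ball: "\<And>z. z \<in> K \<Longrightarrow> norm z < \<rho> \<Longrightarrow> svm_nonneg (T z)"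
    and w: "w \<in> K" "norm w < \<rho>" "0 \<in> T w"
    and y: "y \<in> K"
  shows "svm_nonneg (T y)"
  unfolding svm_nonneg_def
proof
  fix u assume "u \<in> T y"
  \<comment> \<open>This moves \<open>w\<close> towards \<open>y\<close> by at most half the gap
    \<open>\<rho> - norm w\<close>; adding 1 avoids division by zero when
    \<open>y = w\<close>.\<close>
  define t where "t = min 1 ((\<rho> - norm w) / (2 * (norm (y - w) + 1)))"
  have "0 < norm (y - w) + 1" by (simp add: add_nonneg_pos)
  then have t: "0 < t" "t \<le> 1"
    using w(2) by (auto simp: t_def)
  have "t * norm (y - w) \<le> t * (norm (y - w) + 1)"
    using t by (intro mult_left_mono) auto
  also have "\<dots> \<le> (\<rho> - norm w) / (2 * (norm (y - w) + 1)) * (norm (y - w) + 1)"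
    by (intro mult_right_mono) (auto simp: t_def)
  also have "\<dots> = (\<rho> - norm w) / 2"
    using \<open>0 < norm (y - w) + 1\<close> by (simp add: divide_simps)
  also have "\<dots> < \<rho> - norm w"
    using w(2) by simp
  finally have small: "norm w + t * norm (y - w) < \<rho>" by simp
  define z where "z = (1 - t) *\<^sub>R w + t *\<^sub>R y"
  have "z = w + t *\<^sub>R (y - w)" by (simp add: z_def algebra_simps)
  then have "norm z < \<rho>"
    using norm_triangle_ineq[of w "t *\<^sub>R (y - w)"] small t by simp
  moreover have "z \<in> K"
    unfolding z_def using \<open>convex K\<close> w(1) y t by (simp add: convex_alt)
  moreover have "(1 - t) * 0 + t * u \<in> T z"
    unfolding z_def using conv w y \<open>u \<in> T y\<close> t
    by (intro convex_svm_onD[of K]) auto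
  ultimately have "0 \<le> t * u"
    using ball[of z] by (auto simp: svm_nonneg_def)
  with t show "0 \<le> u" by (simp add: zero_le_mult_iff)
qed

theorem theorem4p4:
  fixes K D :: "'a::banach set"
    and F :: "'a \<Rightarrow> 'a \<Rightarrow> real set"
  assumes "reflexive_space TYPE('a)"
    and "K \<noteq> {}" and "convex K" and "closed K"
    and "D \<subseteq> K"
    and "self_segment_dense_in weak_topology D K"
    and "\<forall>y\<in>D. lower_semicontinuous_on (subtopology weak_topology K) (\<lambda>x. F x y) K"
    and "\<forall>x\<in>K. lower_semicontinuous_on (subtopology weak_topology K) (\<lambda>y. F x y) (K - D)"
    and "\<forall>x\<in>K. convex_svm_on K (\<lambda>y. F x y)"
    and "\<forall>x\<in>K. svm_nonneg (F x x) \<and> 0 \<in> F x x"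
    and "\<exists>r>0. \<forall>x\<in>K. norm x > r \<longrightarrow>
           (\<exists>y0\<in>K. norm y0 < norm x \<and> F x y0 \<inter> {..0} \<noteq> {})"
  shows "\<exists>x0\<in>K. \<forall>y\<in>K. svm_nonneg (F x0 y)"
proof -
  obtain r where "r > 0" and coercive: "\<And>x. x \<in> K \<Longrightarrow> r < norm x \<Longrightarrow>
      \<exists>y0\<in>K. norm y0 < norm x \<and> F x y0 \<inter> {..0} \<noteq> {}"
    using assms(11) by blast
  obtain k where "k \<in> K" using \<open>K \<noteq> {}\<close> by blast
  \<comment> \<open>Adding 1 makes both bounds strict: coercivity applies on the sphere of radius
    \<open>\<rho>\<close>, and \<open>k\<close> lies in the open ball.\<close>
  define \<rho> where "\<rho> = max r (norm k) + 1"
  have \<rho>: "r < \<rho>" "norm k < \<rho>" by (auto simp: \<rho>_def)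
  have "k \<in> K \<inter> cball 0 \<rho>" using \<open>k \<in> K\<close> \<rho>(2) by simp
  then have nonempty: "K \<inter> cball 0 \<rho> \<noteq> {}" by blast
  obtain x0 where "x0 \<in> K \<inter> cball 0 \<rho>"
    and x0: "\<And>y. y \<in> D \<inter> cball 0 \<rho> \<Longrightarrow> svm_nonneg (F x0 y)"
    using equilibrium_dense_in_ball[OF assms(1,3,4,5) nonempty, of F] assms(7,9,10) by blast
  then have "x0 \<in> K" "norm x0 \<le> \<rho>" by auto
  have inner: "svm_nonneg (F x0 y)" if "y \<in> K" "norm y < \<rho>" for y
  proof (rule svm_nonneg_dense_extension)
    show "K \<subseteq> closure D"
      by (rule self_segment_dense_in_weak_topology_norm_dense[OF assms(6)])
    show "lower_semicontinuous_on (subtopology weak_topology K) (F x0) (K - D)"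
      using assms(8) \<open>x0 \<in> K\<close> by simp
    \<comment> \<open>Semicontinuity of the map in the first variable at \<open>x0\<close> includes
      nonemptiness of its value there.\<close>
    show "F x0 z \<noteq> {}" if "z \<in> D" for z
      using assms(7) \<open>x0 \<in> K\<close> that
      by (auto simp: lower_semicontinuous_on_def lower_semicontinuous_at_def svm_domain_def)
    show "svm_nonneg (F x0 z)" if "z \<in> D \<inter> ball 0 \<rho>" for z
      using x0 that by simp
    show "y \<in> K \<inter> ball 0 \<rho>"
      using that by simp
  qed (use \<open>D \<subseteq> K\<close> in simp_all)
  \<comment> \<open>The anchor of the last convexity step must lie strictly inside the ball, whereas
    \<open>x0\<close> may be on the sphere.\<close>
  obtain w where w: "w \<in> K" "norm w < \<rho>" "0 \<in> F x0 w"
  proof (cases "norm x0 < \<rho>")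
    case True
    then show ?thesis using that[of x0] assms(10) \<open>x0 \<in> K\<close> by blast
  next
    case False
    with \<open>norm x0 \<le> \<rho>\<close> have "norm x0 = \<rho>" by simp
    then obtain y0 u where "y0 \<in> K" "norm y0 < \<rho>" "u \<in> F x0 y0" "u \<le> 0"
      using coercive[OF \<open>x0 \<in> K\<close>] \<rho>(1) by auto
    \<comment> \<open>Since \<open>y0\<close> lies in the open ball, \<open>inner\<close> gives
      \<open>u \<ge> 0\<close> as well.\<close>
    moreover from this have "u = 0"
      using inner[of y0] by (force simp: svm_nonneg_def)
    ultimately show ?thesis using that by blast
  qed
  have "svm_nonneg (F x0 y)" if "y \<in> K" for y
  proof (rule convex_svm_nonneg_from_ball[of K "F x0" \<rho> w, OF _ \<open>convex K\<close> inner w that])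
    show "convex_svm_on K (F x0)"
      using assms(9) \<open>x0 \<in> K\<close> by simp
  qed
  with \<open>x0 \<in> K\<close> show ?thesis by blast
qed

end
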